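(* Let $\alpha$ be a real number with $0<\alpha\le 0.5$. Then for every integer $K\ge 1$ and every integer $T\ge 1$, the fixed-size ordinally-forgetting encoding (FOFE) with forgetting factor $\alpha$ is unique for vocabulary size $K$ and length bound $T$; that is, if $S$ and $S'$ are two sequences of symbols from a vocabulary of $K$ symbols, each of length between $1$ and $T$, and $S$ and $S'$ have the same FOFE code in $\mathbb{R}^K$, then $S=S'$ (in particular they have the same length).
   Context: Fix a vocabulary of $K$ symbols, identified with $\{1,\dots,K\}$; the symbol $k$ is represented by the one-hot vector in $\mathbb{R}^K$ whose $k$-th entry is $1$ and whose other entries are $0$. Fix a real constant $\alpha$ with $0<\alpha<1$ (the forgetting factor). For a finite sequence $S=(w_1,\dots,w_n)$ of vocabulary symbols, let $\mathbf{e}_t\in\mathbb{R}^K$ be the one-hot vector of $w_t$, and define recursively $\mathbf{z}_0=\mathbf{0}$ and $\mathbf{z}_t=\alpha\,\mathbf{z}_{t-1}+\mathbf{e}_t$ for $1\le t\le n$. The FOFE code of $S$ is $\mathbf{z}_n=\sum_{t=1}^{n}\alpha^{n-t}\mathbf{e}_t\in\mathbb{R}^K$. FOFE (with factor $\alpha$) is called unique for $K$ and $T$ if every sequence $S$ of length at most $T$ over the vocabulary can be recovered unambiguously from its FOFE code, i.e. the map sending a sequence of length between $1$ and $T$ to its FOFE code is injective. *)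

theory Defs
  imports Complex_Main "Jordan_Normal_Form.Matrix"
begin

text \<open>
  The vocabulary is \<open>{1..K}\<close>, and a sequence of symbols is a list over it. Vectors of dimension
  \<open>K\<close> are indexed from \<open>0\<close> to \<open>K - 1\<close>, so the entry of the symbol \<open>k\<close> has index \<open>k - 1\<close>; this
  subtraction is never truncated, since \<open>k \<ge> 1\<close>.
\<close>

definition one_hot :: "nat \<Rightarrow> nat \<Rightarrow> real vec" where
  "one_hot K k = unit_vec K (k - 1)"

text \<open>
  \<open>fofe_state \<alpha> K S t\<close> is the vector \<open>z_t\<close> of the recursion \<open>z_0 = 0\<close>,
  \<open>z_t = \<alpha> z_(t-1) + e_t\<close>. Lists are indexed from \<open>0\<close>, so the symbol \<open>w_(t+1)\<close> is \<open>S ! t\<close>.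
\<close>

primrec fofe_state :: "real \<Rightarrow> nat \<Rightarrow> nat list \<Rightarrow> nat \<Rightarrow> real vec" where
  "fofe_state \<alpha> K S 0 = 0\<^sub>v K"
| "fofe_state \<alpha> K S (Suc t) = \<alpha> \<cdot>\<^sub>v fofe_state \<alpha> K S t + one_hot K (S ! t)"

definition fofe_code :: "real \<Rightarrow> nat \<Rightarrow> nat list \<Rightarrow> real vec" where
  "fofe_code \<alpha> K S = fofe_state \<alpha> K S (length S)"

definition fofe_unique :: "real \<Rightarrow> nat \<Rightarrow> nat \<Rightarrow> bool" where
  "fofe_unique \<alpha> K T \<longleftrightarrow>
     inj_on (fofe_code \<alpha> K) {S. set S \<subseteq> {1..K} \<and> 1 \<le> length S \<and> length S \<le> T}"

lemma fofe_state_carrier: "fofe_state \<alpha> K S t \<in> carrier_vec K"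
  by (induction t) (simp_all add: one_hot_def)

lemma fofe_code_carrier: "fofe_code \<alpha> K S \<in> carrier_vec K"
  by (simp add: fofe_code_def fofe_state_carrier)

lemma fofe_state_index:
  assumes "i < K"
  shows "fofe_state \<alpha> K S t $ i = (\<Sum>s=1..t. \<alpha> ^ (t - s) * one_hot K (S ! (s - 1)) $ i)"
proof (induction t)
  case 0
  then show ?case using assms by simp
next
  case (Suc t)
  have "fofe_state \<alpha> K S (Suc t) $ i = \<alpha> * fofe_state \<alpha> K S t $ i + one_hot K (S ! t) $ i"
    using assms carrier_vecD[OF fofe_state_carrier[of \<alpha> K S t]] by (simp add: one_hot_def)
  also have "\<alpha> * fofe_state \<alpha> K S t $ i =
      (\<Sum>s=1..t. \<alpha> ^ (Suc t - s) * one_hot K (S ! (s - 1)) $ i)"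
    unfolding Suc.IH sum_distrib_left by (rule sum.cong) (auto simp: Suc_diff_le)
  finally show ?case by simp
qed

lemma fofe_code_index:
  assumes "i < K"
  shows "fofe_code \<alpha> K S $ i =
    (\<Sum>t=1..length S. \<alpha> ^ (length S - t) * one_hot K (S ! (t - 1)) $ i)"
  unfolding fofe_code_def by (rule fofe_state_index[OF assms])

end

theory Submission
  imports Defs
begin

text \<open>
  For \<open>\<alpha> \<le> 1 / 2\<close> every entry of a code is nonnegative and less than 2. Since the last symbol adds
  1 to its own entry of \<open>\<alpha> z\<close>, it is the only symbol whose entry is at least 1. Hence the last
  symbol can be read off the code, and removing it and dividing by \<open>\<alpha>\<close> gives the code of the
  rest. The code of the empty sequence has no entry that is at least 1, so the length is recovered
  as well.
\<close>

lemma fofe_state_append: "t \<le> length S \<Longrightarrow> fofe_state \<alpha> K (S @ S') t = fofe_state \<alpha> K S t"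
  by (induction t) (simp_all add: nth_append)

lemma fofe_code_Nil_index: "i < K \<Longrightarrow> fofe_code \<alpha> K [] $ i = 0"
  by (simp add: fofe_code_def)

lemma fofe_code_snoc_index:
  assumes "i < K"
  shows "fofe_code \<alpha> K (S @ [k]) $ i = \<alpha> * fofe_code \<alpha> K S $ i + (if i = k - 1 then 1 else 0)"
  using assms carrier_vecD[OF fofe_state_carrier[of \<alpha> K S "length S"]]
  by (simp add: fofe_code_def fofe_state_append one_hot_def unit_vec_def)

text \<open>The bound 2 is preserved by appending a symbol: an entry below 2 drops below 1 when
  multiplied by \<alpha> \<le> 1/2, and at most 1 is added. Strictness is what still separates the
  two cases at \<alpha> = 1/2.\<close>

lemma fofe_code_index_bounds:
  assumes "0 < \<alpha>" "\<alpha> \<le> 1 / 2" "i < K"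
  shows "0 \<le> fofe_code \<alpha> K S $ i" "\<alpha> * fofe_code \<alpha> K S $ i < 1"
proof -
  have half: "\<alpha> * x < 1" if "0 \<le> x" "x < 2" for x :: real
    using mult_right_mono[OF assms(2) that(1)] that(2) by simp
  have "0 \<le> fofe_code \<alpha> K S $ i \<and> fofe_code \<alpha> K S $ i < 2"
  proof (induction S rule: rev_induct)
    case Nil
    then show ?case using assms(3) by (simp add: fofe_code_Nil_index)
  next
    case (snoc k S)
    then have "0 \<le> \<alpha> * fofe_code \<alpha> K S $ i" "\<alpha> * fofe_code \<alpha> K S $ i < 1"
      using assms(1) half by auto
    then show ?case using assms(3) by (auto simp: fofe_code_snoc_index)
  qed
  then show "0 \<le> fofe_code \<alpha> K S $ i" "\<alpha> * fofe_code \<alpha> K S $ i < 1"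
    using half by auto
qed

lemma fofe_code_snoc_index_ge_1_iff:
  assumes "0 < \<alpha>" "\<alpha> \<le> 1 / 2" "i < K"
  shows "1 \<le> fofe_code \<alpha> K (S @ [k]) $ i \<longleftrightarrow> i = k - 1"
  using fofe_code_index_bounds[OF assms, of S] assms by (auto simp: fofe_code_snoc_index)

lemma fofe_code_snoc_neq_Nil:
  assumes "0 < \<alpha>" "\<alpha> \<le> 1 / 2" "k \<in> {1..K}"
  shows "fofe_code \<alpha> K (S @ [k]) \<noteq> fofe_code \<alpha> K []"
proof
  assume eq: "fofe_code \<alpha> K (S @ [k]) = fofe_code \<alpha> K []"
  have "k - 1 < K" using assms(3) by auto
  then show False
    using fofe_code_snoc_index_ge_1_iff[OF assms(1,2), of "k - 1" K S k]
    by (simp add: eq fofe_code_Nil_index)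
qed

lemma fofe_code_snoc_inject:
  assumes "0 < \<alpha>" "\<alpha> \<le> 1 / 2" "k \<in> {1..K}" "k' \<in> {1..K}"
    and eq: "fofe_code \<alpha> K (S @ [k]) = fofe_code \<alpha> K (S' @ [k'])"
  shows "k = k'" "fofe_code \<alpha> K S = fofe_code \<alpha> K S'"
proof -
  have "k - 1 < K" using assms(3) by auto
  \<comment> \<open>Entry \<open>k - 1\<close> of the common code is at least 1; read as an entry of
    the code of \<open>S' @ [k']\<close>, it must be the one at \<open>k' - 1\<close>.\<close>
  then have "k - 1 = k' - 1"
    using fofe_code_snoc_index_ge_1_iff[OF assms(1,2)] eq by metis
  \<comment> \<open>Truncated subtraction would confuse 0 and 1, so membership in
    \<open>{1..K}\<close> matters here.\<close>
  then show "k = k'" using assms(3,4) by auto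
  show "fofe_code \<alpha> K S = fofe_code \<alpha> K S'"
  proof (rule eq_vecI)
    fix i assume "i < dim_vec (fofe_code \<alpha> K S')"
    then have "i < K" using carrier_vecD[OF fofe_code_carrier[of \<alpha> K S']] by simp
    then show "fofe_code \<alpha> K S $ i = fofe_code \<alpha> K S' $ i"
      \<comment> \<open>The equal last symbols cancel, and the remaining factor \<alpha> is
        nonzero.\<close>
      using arg_cong[OF eq, of "\<lambda>v. v $ i"] \<open>k = k'\<close> assms(1)
      by (simp add: fofe_code_snoc_index)
  qed (simp add: carrier_vecD[OF fofe_code_carrier])
qed

text \<open>Allowing the empty sequence and every length keeps the domain closed under removing the
  last symbol, as the induction from the right requires.\<close>

lemma inj_on_fofe_code:
  assumes "0 < \<alpha>" "\<alpha> \<le> 1 / 2"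
  shows "inj_on (fofe_code \<alpha> K) (lists {1..K})"
proof (rule inj_onI)
  fix S S'
  assume "S \<in> lists {1..K}" "S' \<in> lists {1..K}" "fofe_code \<alpha> K S = fofe_code \<alpha> K S'"
  then show "S = S'"
  proof (induction S arbitrary: S' rule: rev_induct)
    case Nil
    show ?case
    proof (cases S' rule: rev_cases)
      case (snoc R k)
      then show ?thesis
        using Nil fofe_code_snoc_neq_Nil[OF assms, of k K R] by auto
    qed simp
  next
    case (snoc k S)
    show ?case
    proof (cases S' rule: rev_cases)
      case Nil
      then show ?thesis
        using snoc.prems fofe_code_snoc_neq_Nil[OF assms, of k K S] by auto
    next
      case (snoc R k')
      then show ?thesis
        using snoc.prems snoc.IH[of R] fofe_code_snoc_inject[OF assms, of k K k' S R] by auto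
    qed
  qed
qed

theorem theorem1:
  fixes \<alpha> :: real and K T :: nat
  assumes "0 < \<alpha>" and "\<alpha> \<le> 1 / 2" and "K \<ge> 1" and "T \<ge> 1"
  shows "fofe_unique \<alpha> K T"
  unfolding fofe_unique_def
  by (rule inj_on_subset[OF inj_on_fofe_code[OF assms(1,2)]]) auto

end
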